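(* Let $A\in\mathbb{R}^{m\times n}$, $y\in\mathbb{R}^m$, $\rho\ge 0$ and $\overline{\mathcal F}_{y,\rho}=\{w\in\mathbb{R}^m : \|y-|w|^2\|\le\rho\}$. Let $R:\mathbb{R}^n\to\mathbb{R}\cup\{+\infty\}$ be a proper and lower semicontinuous function. Assume that $A(\mathrm{dom}(R))\cap\overline{\mathcal F}_{y,\rho}\ne\emptyset$, that $R$ is non-negative, and that $\ker(R_\infty)\cap\ker(A)=\{0\}$. Then the set of minimizers of $$\inf_{x\in\mathbb{R}^n} R(x)\quad\text{subject to}\quad \|y-|Ax|^2\|\le\rho$$ is a non-empty compact set.
   Context: $\|\cdot\|$ is the Euclidean norm; for vectors, $|\cdot|$ and squares are componentwise. $\mathrm{dom}(R)=\{x: R(x)<+\infty\}$. $R_\infty(z)=\liminf_{z'\to z,\ t\to+\infty}R(tz')/t$ is the asymptotic (recession) function of $R$. For a function $f$, $\ker(f)=\{z: f(z)=0\}$; $\ker(A)$ is the usual null space. No convexity of $R$ is assumed. *)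

theory Defs
  imports "HOL-Analysis.Analysis"
begin

text \<open>A function into \<open>\<real> \<union> {+\<infinity>}\<close> is an \<^typ>\<open>ereal\<close>-valued function that omits
  \<open>-\<infinity>\<close>; this restriction on the codomain is the first conjunct of \<open>proper\<close>.\<close>

definition proper :: "('a \<Rightarrow> ereal) \<Rightarrow> bool" where
  "proper R \<longleftrightarrow> (\<forall>x. R x \<noteq> - \<infinity>) \<and> (\<exists>x. R x < \<infinity>)"

definition eff_dom :: "('a \<Rightarrow> ereal) \<Rightarrow> 'a set" where
  "eff_dom R = {x. R x < \<infinity>}"

definition lower_semicontinuous :: "('a::topological_space \<Rightarrow> ereal) \<Rightarrow> bool" where
  "lower_semicontinuous R \<longleftrightarrow> (\<forall>x. R x \<le> Liminf (nhds x) R)"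

text \<open>The limit inferior is joint in \<open>(z', t)\<close>, and \<open>z' = z\<close> is admitted
  (\<^const>\<open>nhds\<close>, not \<^const>\<open>at\<close>).\<close>

definition asymptotic_fun :: "('a::real_normed_vector \<Rightarrow> ereal) \<Rightarrow> 'a \<Rightarrow> ereal" where
  "asymptotic_fun R z =
     Liminf (nhds z \<times>\<^sub>F at_top) (\<lambda>(z', t). R (t *\<^sub>R z') / ereal t)"

definition fun_ker :: "('a \<Rightarrow> ereal) \<Rightarrow> 'a set" where
  "fun_ker f = {z. f z = 0}"

definition mat_ker :: "real ^ 'n ^ 'm \<Rightarrow> (real ^ 'n) set" where
  "mat_ker A = {x. A *v x = 0}"

definition abs_sq :: "real ^ 'm \<Rightarrow> real ^ 'm" where
  "abs_sq w = (\<chi> i. \<bar>w $ i\<bar>\<^sup>2)"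

definition feasible_data :: "real ^ 'm \<Rightarrow> real \<Rightarrow> (real ^ 'm) set" where
  "feasible_data y \<rho> = {w. norm (y - abs_sq w) \<le> \<rho>}"

end

(* An unbounded sequence of feasible points with R bounded above would, after normalisation,
   accumulate at a unit vector in the kernels of both A and the asymptotic function of R.
   Hence the feasible sublevel sets of R are compact; being totally ordered by inclusion, they
   have a common point, and the set of minimizers is itself such a sublevel set. *)
theory Submission
  imports Defs
begin

lemma closed_sublevel:
  assumes "lower_semicontinuous R"
  shows "closed {x. R x \<le> c}"
proof -
  have "\<exists>T. open T \<and> x \<in> T \<and> T \<subseteq> {x. c < R x}" if "c < R x" for x
  proof -
    have "c < Liminf (nhds x) R"
      using assms that unfolding lower_semicontinuous_def by (meson less_le_trans)
    then have "eventually (\<lambda>u. c < R u) (nhds x)"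
      by (rule less_LiminfD)
    then show ?thesis
      by (auto simp: eventually_nhds)
  qed
  then have "open {x. c < R x}"
    by (subst open_subopen) auto
  moreover have "{x. c < R x} = - {x. R x \<le> c}"
    by auto
  ultimately show ?thesis
    by (simp add: closed_def)
qed

text \<open>The sign of the quotient is controlled only for t > 0, which holds eventually along
  \<open>at_top\<close>. This later upgrades a nonzero asymptotic value to a positive one.\<close>

lemma asymptotic_fun_nonneg:
  assumes "\<And>x. 0 \<le> R x"
  shows "0 \<le> asymptotic_fun R z"
proof -
  have "eventually (\<lambda>p. 0 < snd p) (nhds z \<times>\<^sub>F (at_top :: real filter))"
    using eventually_gt_at_top[of 0] filterlim_snd
    by (rule eventually_compose_filterlim)
  then have "eventually (\<lambda>p. 0 \<le> (case p of (z', t) \<Rightarrow> R (t *\<^sub>R z') / ereal t))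
      (nhds z \<times>\<^sub>F at_top)"
    by eventually_elim (auto simp: assms intro!: zero_le_divide_ereal)
  then show ?thesis
    unfolding asymptotic_fun_def by (rule Liminf_bounded)
qed

lemma bounded_sublevel_preimage:
  fixes f :: "'a::euclidean_space \<Rightarrow> 'b::real_normed_vector" and R :: "'a \<Rightarrow> ereal"
  assumes lin: "bounded_linear f"
    and nonneg: "\<And>x. 0 \<le> R x"
    and ker: "fun_ker (asymptotic_fun R) \<inter> {x. f x = 0} \<subseteq> {0}"
    and B: "bounded B"
  shows "bounded {x. f x \<in> B \<and> R x \<le> ereal c}"
proof (rule ccontr)
  interpret bounded_linear f by (rule lin)
  assume "\<not> ?thesis"
  then have "\<forall>k. \<exists>x. f x \<in> B \<and> R x \<le> ereal c \<and> real k < norm x"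
    unfolding bounded_iff by (auto simp: not_le)
  then obtain x where x: "\<And>k. f (x k) \<in> B" "\<And>k. R (x k) \<le> ereal c" "\<And>k. real k < norm (x k)"
    by metis
  \<comment> \<open>The strict bound \<open>real k < norm (x k)\<close> also covers k = 0, so every
    \<open>x k\<close> can be normalised.\<close>
  have pos: "0 < norm (x k)" for k
    using x(3)[of k] of_nat_0_le_iff[of k] by linarith
  define u where "u k = x k /\<^sub>R norm (x k)" for k
  have nu: "norm (u k) = 1" for k
    using pos[of k] by (auto simp: u_def)
  then have "\<forall>k. u k \<in> sphere 0 1"
    by simp
  then obtain z r where z: "z \<in> sphere 0 1" and r: "strict_mono (r :: nat \<Rightarrow> nat)"
    and lim: "(u \<circ> r) \<longlonglongrightarrow> z"
    using compact_sphere[of "0::'a" 1] unfolding compact_def by meson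
  have "filterlim (\<lambda>k. norm (x k)) at_top sequentially"
    using filterlim_real_sequentially
    by (rule filterlim_at_top_mono) (intro always_eventually allI less_imp_le x(3))
  then have top: "filterlim (\<lambda>k. norm (x (r k))) at_top sequentially"
    by (rule filterlim_compose) (rule filterlim_subseq[OF r])
  obtain b where b: "\<And>w. w \<in> B \<Longrightarrow> norm w \<le> b"
    using B unfolding bounded_iff by auto
  \<comment> \<open>By homogeneity this is \<open>f (x (r k))\<close>, bounded by \<open>b\<close>,
    divided by a diverging norm.\<close>
  have "(\<lambda>k. f (u (r k))) \<longlonglongrightarrow> 0"
  proof (rule Lim_null_comparison)
    show "(\<lambda>k. b / norm (x (r k))) \<longlonglongrightarrow> 0"
      by (rule real_tendsto_divide_at_top[OF tendsto_const top])
    show "\<forall>\<^sub>F k in sequentially. norm (f (u (r k))) \<le> b / norm (x (r k))"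
      using b[OF x(1)] pos by (auto simp: u_def scaleR divide_simps)
  qed
  moreover have "(\<lambda>k. f (u (r k))) \<longlonglongrightarrow> f z"
    using tendsto[OF lim] by (simp add: o_def)
  ultimately have fz: "f z = 0"
    using LIMSEQ_unique by blast
  have "z \<noteq> 0"
    using z by auto
  then have "asymptotic_fun R z \<noteq> 0"
    using ker fz by (auto simp: fun_ker_def)
  then have "0 < asymptotic_fun R z"
    using asymptotic_fun_nonneg[of R z] nonneg by simp
  \<comment> \<open>The asymptotic value may be infinite; a positive real below it suffices.\<close>
  then obtain e where e: "0 < ereal e" "ereal e < asymptotic_fun R z"
    using ereal_dense2 by blast
  have "eventually (\<lambda>(z', t). ereal e < R (t *\<^sub>R z') / ereal t) (nhds z \<times>\<^sub>F at_top)"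
    using less_LiminfD[OF e(2)[unfolded asymptotic_fun_def]] by (simp add: case_prod_unfold)
  \<comment> \<open>The pairs \<open>(u (r k), norm (x (r k)))\<close> tend to z and infinity, and
    their product is \<open>x (r k)\<close>. Since \<open>u (r k)\<close> need not equal
    \<open>z\<close>, the limit inferior has to be joint in direction and scale.\<close>
  then have "eventually (\<lambda>k. case
      (u (r k), norm (x (r k))) of (z', t) \<Rightarrow> ereal e < R (t *\<^sub>R z') / ereal t) sequentially"
    by (rule eventually_compose_filterlim)
      (use lim top in \<open>auto intro: filterlim_Pair simp: o_def\<close>)
  then have "eventually (\<lambda>k. ereal e < R (x (r k)) / ereal (norm (x (r k)))) sequentially"
    using pos by (simp add: u_def)
  \<comment> \<open>The level \<open>c\<close> is fixed while the norms diverge, so the same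
    quotients are eventually below \<open>e\<close>.\<close>
  moreover have "eventually (\<lambda>k. c / norm (x (r k)) < e) sequentially"
    using e(1) by (intro order_tendstoD(2)[OF real_tendsto_divide_at_top[OF tendsto_const top]]) simp
  ultimately have "eventually (\<lambda>k. False) sequentially"
  proof eventually_elim
    case (elim k)
    have "R (x (r k)) / ereal (norm (x (r k))) \<le> ereal c / ereal (norm (x (r k)))"
      using x(2) pos by (intro ereal_divide_right_mono) auto
    also have "\<dots> = ereal (c / norm (x (r k)))"
      using pos[of "r k"] by simp
    finally have "ereal e < ereal (c / norm (x (r k)))"
      by (rule less_le_trans[OF elim(1)])
    with elim(2) show False
      by simp
  qed
  then show False
    by simp
qed

lemma closed_feasible_data: "closed (feasible_data y \<rho>)"
  unfolding feasible_data_def abs_sq_def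
  by (intro closed_Collect_le continuous_intros)

text \<open>Closeness to \<open>y\<close> bounds every squared entry of \<open>w\<close> by
  \<open>norm y + \<rho>\<close>, and the l1 norm dominates the Euclidean one.\<close>

lemma bounded_feasible_data: "bounded (feasible_data (y :: real ^ 'm) \<rho>)"
proof -
  have "norm w \<le> (\<Sum>i\<in>(UNIV :: 'm set). 1 + norm y + \<rho>)" if "w \<in> feasible_data y \<rho>" for w
  proof -
    have "\<bar>w $ i\<bar> \<le> 1 + norm y + \<rho>" for i
    proof -
      have "\<bar>(y - abs_sq w) $ i\<bar> \<le> \<rho>"
        using that component_le_norm_cart[of "y - abs_sq w" i] by (simp add: feasible_data_def)
      moreover have "\<bar>y $ i\<bar> \<le> norm y"
        by (rule component_le_norm_cart)
      ultimately have "\<bar>w $ i\<bar>\<^sup>2 \<le> norm y + \<rho>"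
        by (simp add: abs_sq_def)
      \<comment> \<open>Expanding (t - 1)^2 >= 0 for t >= 0 gives t <= 1 + t^2. This avoids a square
        root and is the source of the constant 1.\<close>
      moreover have "\<bar>w $ i\<bar> \<le> 1 + \<bar>w $ i\<bar>\<^sup>2"
        using zero_le_power2[of "\<bar>w $ i\<bar> - 1"] by (simp add: power2_diff)
      ultimately show ?thesis
        by linarith
    qed
    then show ?thesis
      by (intro order.trans[OF norm_le_l1_cart] sum_mono)
  qed
  then show ?thesis
    unfolding bounded_iff by blast
qed

text \<open>Only attained values serve as levels, so no infimum has to exist in the order and a bare
  linear order suffices.\<close>

lemma arg_min_compact_sublevels:
  fixes R :: "'a::heine_borel \<Rightarrow> 'b::linorder"
  assumes x0: "P x0"
    and compact: "\<And>c. c \<le> R x0 \<Longrightarrow> compact {x. P x \<and> R x \<le> c}"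
  shows "{x. is_arg_min R P x} \<noteq> {} \<and> compact {x. is_arg_min R P x}"
proof -
  define L where "L c = {x. P x \<and> R x \<le> c}" for c
  \<comment> \<open>Indexing by points of \<open>L (R x0)\<close> keeps all levels at most
    \<open>R x0\<close>, where compactness is assumed, and makes each set non-empty, since it
    contains its own index.\<close>
  define F where "F = (\<lambda>x. L (R x)) ` L (R x0)"
  have "\<Inter> F \<noteq> {}"
  proof (rule compact_chain)
    show "compact S" if "S \<in> F" for S
      using that compact by (auto simp: F_def L_def)
    show "{} \<notin> F"
      by (auto simp: F_def L_def)
    show "S \<subseteq> T \<or> T \<subseteq> S" if "S \<in> F \<and> T \<in> F" for S T
    proof -
      have "L c \<subseteq> L d \<or> L d \<subseteq> L c" for c d
        using linear[of c d] by (auto simp: L_def)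
      then show ?thesis
        using that by (auto simp: F_def)
    qed
  qed
  then obtain x where "x \<in> \<Inter> F"
    by blast
  then have x: "x \<in> L (R v)" if "v \<in> L (R x0)" for v
    using that by (auto simp: F_def)
  have Px: "P x" and le: "R x \<le> R x0"
    using x[of x0] x0 by (auto simp: L_def)
  \<comment> \<open>A competitor outside \<open>L (R x0)\<close> has a value above
    \<open>R x0\<close>, hence above \<open>R x\<close>.\<close>
  have min: "R x \<le> R v" if "P v" for v
    using x[of v] le that by (cases "R v \<le> R x0") (auto simp: L_def)
  then have "{x. is_arg_min R P x} = L (R x)"
    using Px by (fastforce simp: is_arg_min_def L_def not_less)
  then show ?thesis
    using Px compact[OF le] by (auto simp: L_def)
qed

theorem proposition4p1:
  fixes A :: "real ^ 'n ^ 'm" and y :: "real ^ 'm" and \<rho> :: real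
    and R :: "real ^ 'n \<Rightarrow> ereal"
  assumes "\<rho> \<ge> 0"
    and "proper R"
    and "lower_semicontinuous R"
    and "(\<lambda>x. A *v x) ` eff_dom R \<inter> feasible_data y \<rho> \<noteq> {}"
    and "\<forall>x. R x \<ge> 0"
    and "fun_ker (asymptotic_fun R) \<inter> mat_ker A = {0}"
  shows "{x. is_arg_min R (\<lambda>x. norm (y - abs_sq (A *v x)) \<le> \<rho>) x} \<noteq> {}
    \<and> compact {x. is_arg_min R (\<lambda>x. norm (y - abs_sq (A *v x)) \<le> \<rho>) x}"
proof -
  obtain x0 where x0: "R x0 < \<infinity>" "A *v x0 \<in> feasible_data y \<rho>"
    using assms(4) by (auto simp: eff_dom_def)
  have lin: "bounded_linear ((*v) A)"
    by (rule matrix_vector_mul_bounded_linear)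
  show ?thesis
  proof (rule arg_min_compact_sublevels)
    show "norm (y - abs_sq (A *v x0)) \<le> \<rho>"
      using x0(2) by (simp add: feasible_data_def)
    fix c assume c: "c \<le> R x0"
    \<comment> \<open>The boundedness lemma needs a real level, whereas \<open>c\<close> is an
      extended real. The finite value \<open>d\<close> serves for all \<open>c\<close> at once,
      because each sublevel set lies in the one at \<open>d\<close>.\<close>
    obtain d where d: "R x0 = ereal d"
      using x0(1) spec[OF assms(5), of x0] by (cases "R x0") auto
    have eq: "{x. norm (y - abs_sq (A *v x)) \<le> \<rho> \<and> R x \<le> c}
        = ((*v) A) -` feasible_data y \<rho> \<inter> {x. R x \<le> c}"
      by (auto simp: feasible_data_def)
    have "closed (((*v) A) -` feasible_data y \<rho> \<inter> {x. R x \<le> c})"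
      by (intro closed_Int closed_vimage closed_feasible_data closed_sublevel assms(3)
          linear_continuous_on[OF lin])
    moreover have "bounded {x. A *v x \<in> feasible_data y \<rho> \<and> R x \<le> ereal d}"
      using lin _ _ bounded_feasible_data
      by (rule bounded_sublevel_preimage) (use assms(5,6) in \<open>auto simp: mat_ker_def\<close>)
    then have "bounded (((*v) A) -` feasible_data y \<rho> \<inter> {x. R x \<le> c})"
      by (rule bounded_subset) (use c d in auto)
    ultimately show "compact {x. norm (y - abs_sq (A *v x)) \<le> \<rho> \<and> R x \<le> c}"
      unfolding eq compact_eq_bounded_closed by simp
  qed
qed

end
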